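(* Let $k > 0$ be a real number. The exceptional values in $(-k,0)$ associated with $k$ are given by $$c_{n-1}(k) = -\sqrt{2kn - n^2} \qquad (n \in \mathbb{N},\ n < k);$$ that is, the set of exceptional values is $\{-\sqrt{2kn-n^2} : n\in\mathbb{N},\ n<k\}$, and for each $n \in \mathbb{N}$ with $n<k$ the exceptional value with index $n-1$ is $-\sqrt{2kn-n^2}$. Consequently, if $N \in \mathbb{N}_0$ and $k \in (N, N+1]$, there are exactly $N$ exceptional values in $(-k,0)$.
   Context: $\mathbb{N}=\{1,2,3,\dots\}$, $\mathbb{N}_0=\mathbb{N}\cup\{0\}$. For real $k>0$ and $c\in(-k,0)$ consider the differential equation $$\varrho\,\vartheta'(\varrho) = c + \Bigl(k - \frac{1}{\varrho}\Bigr)\sin 2\vartheta(\varrho) \qquad (\varrho>0) \qquad ( * )$$ for real-valued functions $\vartheta$ on $(0,\infty)$. Define $\vartheta_\pm(c,k)$ by $0<\vartheta_-(c,k)<\pi/4<\vartheta_+(c,k)<\pi/2$ and $\tan\vartheta_\pm(c,k) = \dfrac{k\pm\sqrt{k^2-c^2}}{-c}$ (so $\sin 2\vartheta_\pm(c,k)=-c/k$). The following facts are known. (a) There is a unique solution $\vartheta_0(\cdot,c)$ of $( * )$ with $\lim_{\varrho\to0}\vartheta_0(\varrho,c)=\pi$; every other solution either differs from $\vartheta_0$ by a constant integer multiple of $\pi$ or tends to $\pi/2$ modulo $\pi$ as $\varrho\to0$; for fixed $\hat\varrho>0$, $c\mapsto\vartheta_0(\hat\varrho,c)$ is continuous and non-decreasing.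 (b) There is a unique solution $\vartheta_\infty(\cdot,c)$ of $( * )$ with $\lim_{\varrho\to\infty}\vartheta_\infty(\varrho,c)=\vartheta_-(c,k)$; every other solution either differs from $\vartheta_\infty$ by a constant integer multiple of $\pi$ or tends to $\vartheta_+(c,k)$ modulo $\pi$ as $\varrho\to\infty$; for fixed $\hat\varrho>0$, $c\mapsto\vartheta_\infty(\hat\varrho,c)$ is continuous and strictly decreasing. A number $c\in(-k,0)$ is called an exceptional value (for the given $k$; equivalently, for the Dirac operator with anomalous magnetic moment $H_a(k)$) if $\vartheta_0(\cdot,c)$ and $\vartheta_\infty(\cdot,c)$ differ by a constant integer multiple of $\pi$. The exceptional value with index $m\in\mathbb{N}_0$, denoted $c_m = c_m(k)$, is the one satisfying $\lim_{\varrho\to\infty}\vartheta_0(\varrho,c_m)=\vartheta_-(c_m,k)-m\pi$. *)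

theory Defs
  imports "HOL-Analysis.Analysis"
begin

text \<open>
  Functions on $(0,\infty)$ are represented by total functions on the reals; all conditions below
  only concern their values at positive arguments.
\<close>

definition solution :: "real \<Rightarrow> real \<Rightarrow> (real \<Rightarrow> real) \<Rightarrow> bool" where
  "solution k c \<theta> \<longleftrightarrow>
     (\<forall>\<rho>>0. \<theta> differentiable (at \<rho>) \<and>
            \<rho> * deriv \<theta> \<rho> = c + (k - 1 / \<rho>) * sin (2 * \<theta> \<rho>))"

definition theta_minus :: "real \<Rightarrow> real \<Rightarrow> real" where
  "theta_minus c k = arctan ((k - sqrt (k\<^sup>2 - c\<^sup>2)) / (- c))"

text \<open>
  In the relevant parameter range, this is the unique angle in $(0,\pi/4)$ with the given tangent.
\<close>

lemma theta_minus_unique: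
  assumes "- k < c" "c < 0"
  shows "0 < t \<and> t < pi / 4 \<and> tan t = (k - sqrt (k\<^sup>2 - c\<^sup>2)) / (- c) \<longleftrightarrow> t = theta_minus c k"
proof
  assume t: "0 < t \<and> t < pi / 4 \<and> tan t = (k - sqrt (k\<^sup>2 - c\<^sup>2)) / (- c)"
  then have "arctan (tan t) = t" by (intro arctan_tan) auto
  with t show "t = theta_minus c k" by (simp add: theta_minus_def)
next
  define s where "s = sqrt (k\<^sup>2 - c\<^sup>2)"
  have c2: "c\<^sup>2 < k\<^sup>2"
    using assms power_strict_mono[of "- c" k 2] by simp
  then have s2: "s\<^sup>2 = k\<^sup>2 - c\<^sup>2" and s0: "0 < s" by (simp_all add: s_def)
  have "s < k"
    by (rule power_less_imp_less_base[of _ 2]) (use assms s2 in auto)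
  moreover have "k + c < s"
  proof (rule power_less_imp_less_base[of _ 2])
    have "0 < (- c) * (k + c)" using assms by (intro mult_pos_pos) auto
    then show "(k + c)\<^sup>2 < s\<^sup>2"
      unfolding s2 by (simp add: power2_eq_square algebra_simps)
  qed (use s0 in auto)
  ultimately have q: "0 < (k - s) / (- c)" "(k - s) / (- c) < 1"
    using assms by (simp_all add: field_simps)
  then have "arctan ((k - s) / (- c)) < arctan 1"
    by (simp only: arctan_less_iff)
  moreover assume "t = theta_minus c k"
  ultimately show "0 < t \<and> t < pi / 4 \<and> tan t = (k - sqrt (k\<^sup>2 - c\<^sup>2)) / (- c)"
    using q by (simp only: theta_minus_def s_def[symmetric] tan_arctan arctan_one
        zero_less_arctan_iff)
qed

definition is_theta_0 :: "real \<Rightarrow> real \<Rightarrow> (real \<Rightarrow> real) \<Rightarrow> bool" where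
  "is_theta_0 k c \<theta> \<longleftrightarrow> solution k c \<theta> \<and> (\<theta> \<longlongrightarrow> pi) (at_right 0)"

definition is_theta_infinity :: "real \<Rightarrow> real \<Rightarrow> (real \<Rightarrow> real) \<Rightarrow> bool" where
  "is_theta_infinity k c \<theta> \<longleftrightarrow> solution k c \<theta> \<and> (\<theta> \<longlongrightarrow> theta_minus c k) at_top"

text \<open>
  The solutions singled out by \<open>is_theta_0\<close> and \<open>is_theta_infinity\<close> are unique on
  $(0,\infty)$, so the existential quantifiers below refer to specific functions there.
\<close>

definition exceptional_value :: "real \<Rightarrow> real \<Rightarrow> bool" where
  "exceptional_value k c \<longleftrightarrow> - k < c \<and> c < 0 \<and>
     (\<exists>\<theta>\<^sub>0 \<theta>\<^sub>i. is_theta_0 k c \<theta>\<^sub>0 \<and> is_theta_infinity k c \<theta>\<^sub>i \<and>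
        (\<exists>j::int. \<forall>\<rho>>0. \<theta>\<^sub>0 \<rho> = \<theta>\<^sub>i \<rho> + of_int j * pi))"

definition exceptional_value_with_index :: "real \<Rightarrow> nat \<Rightarrow> real \<Rightarrow> bool" where
  "exceptional_value_with_index k m c \<longleftrightarrow> exceptional_value k c \<and>
     (\<exists>\<theta>\<^sub>0. is_theta_0 k c \<theta>\<^sub>0 \<and> (\<theta>\<^sub>0 \<longlongrightarrow> theta_minus c k - real m * pi) at_top)"

end

theory Submission
  imports Defs
begin

text \<open>
  Equation $(*)$ says that $\vartheta$ is the polar angle of a nonzero solution of the linear system
  $u' = -(k/\varrho - 1/\varrho^2) u - (c/\varrho) v$,
  $v' = (c/\varrho) u + (k/\varrho - 1/\varrho^2) v$. The angle tends to a multiple of $\pi$ at $0$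
  exactly for the solutions that decay there like $e^{-1/\varrho} \varrho^{-k}$. Dividing out this
  positive factor does not change the angle and leaves $U$, $V = -\varrho U'/c$ with
  $\varrho^2 U'' + ((1-2k)\varrho + 2) U' + c^2 U = 0$. For $c^2 = 2kn - n^2$ with
  $n \le k$ this equation has a polynomial solution $Q$ of degree exactly $n$ with $Q(0) = 1$
  (\<open>angle_polynomial_exists\<close>). Then $V/U \to 0$ at $0$ and
  $V/U \to -n/c = \tan\vartheta_-$ at infinity, so $c = -\sqrt{2kn - n^2}$ is exceptional for
  $1 \le n < k$.

  Everything else is the comparison principle \<open>solution_comparison\<close>: among solutions tending
  to $\pi$ at $0$, a gap $c_1 - c_2 > |k_1 - k_2|$ orders the angles for all $\varrho$. Since
  $\vartheta_-$ strictly decreases in $c$, the index of an exceptional value strictly increases as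
  $c$ decreases (\<open>index_strict_mono\<close>). Two consequences finish the proof.

  \<^item> The index belonging to $n$ is $n - 1$. Each half-turn of the angle forces a positive zero of
    $Q$, so the index is at most $n - 1$; strict monotonicity along $n = 0, 1, 2, \dots$, starting
    at $c = 0$ with the constant solution $\pi$ of index $-1$, gives the other bound.
  \<^item> There are no further exceptional values. The constant solution bounds the index $m$ below by
    $0$. For the upper bound let $N = \lceil k \rceil$ and use the polynomial solution with
    parameters $(N, -N)$ as a barrier: its limit is $\pi/4 - (N-1)\pi$, and
    $c - (-N) > N - k$ is just $c > -k$, so it lies below every solution that starts at $\pi$ for
    $c \in (-k, 0)$. Hence $m + 1 < N$, that is, $m + 1 < k$, and the value belonging to
    $n = m + 1$ is available; it has the same index $m$, so by strict monotonicity it equals $c$.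
\<close>

section \<open>Solutions and their comparison\<close>

lemma solution_iff_has_derivative:
  "solution k c \<theta> \<longleftrightarrow>
     (\<forall>\<rho>>0. (\<theta> has_real_derivative (c + (k - 1 / \<rho>) * sin (2 * \<theta> \<rho>)) / \<rho>) (at \<rho>))"
  (is "_ = ?R")
proof
  assume s: "solution k c \<theta>"
  show ?R
  proof (intro allI impI)
    fix \<rho> :: real assume \<rho>: "\<rho> > 0"
    with s have "(\<theta> has_real_derivative deriv \<theta> \<rho>) (at \<rho>)"
      by (simp add: solution_def DERIV_deriv_iff_real_differentiable)
    moreover have "deriv \<theta> \<rho> = (c + (k - 1 / \<rho>) * sin (2 * \<theta> \<rho>)) / \<rho>"
      using s \<rho> by (simp add: solution_def nonzero_eq_divide_eq mult.commute)
    ultimately show "(\<theta> has_real_derivative (c + (k - 1 / \<rho>) * sin (2 * \<theta> \<rho>)) / \<rho>) (at \<rho>)"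
      by simp
  qed
next
  assume R: ?R
  show "solution k c \<theta>"
    unfolding solution_def
  proof (intro allI impI conjI)
    fix \<rho> :: real assume \<rho>: "\<rho> > 0"
    with R have d: "(\<theta> has_real_derivative (c + (k - 1 / \<rho>) * sin (2 * \<theta> \<rho>)) / \<rho>) (at \<rho>)"
      by blast
    then show "\<theta> differentiable (at \<rho>)"
      using real_differentiable_def by blast
    show "\<rho> * deriv \<theta> \<rho> = c + (k - 1 / \<rho>) * sin (2 * \<theta> \<rho>)"
      using DERIV_imp_deriv[OF d] \<rho> by simp
  qed
qed

lemma sin_add_int_pi_double: "sin (2 * (t + of_int j * pi)) = sin (2 * t)"
proof -
  have "sin (2 * (t + of_int j * pi)) = sin (2 * t + 2 * pi * of_int j)"
    by (simp add: algebra_simps)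
  then show ?thesis
    by (simp add: sin_add sin_int_2pin cos_int_2pin)
qed

lemma solution_shift:
  assumes "solution k c \<theta>"
  shows "solution k c (\<lambda>\<rho>. \<theta> \<rho> + of_int j * pi)"
  using assms unfolding solution_iff_has_derivative sin_add_int_pi_double
  by (auto intro!: derivative_eq_intros)

lemma solution_continuous_on:
  assumes "solution k c \<theta>"
  shows "continuous_on {0<..} \<theta>"
  using assms unfolding solution_iff_has_derivative
  by (auto intro!: continuous_at_imp_continuous_on dest: DERIV_isCont)

text \<open>
  For the difference of two angles the sign of the derivative is known only where the difference
  vanishes. That suffices to propagate its sign to the left: otherwise the last nonpositive point
  would be a zero crossed upwards.
\<close>

lemma positive_before_downward_zeros:
  fixes f f' :: "real \<Rightarrow> real"
  assumes "a < b" "f b \<ge> 0"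
    and der: "\<And>x. a \<le> x \<Longrightarrow> x \<le> b \<Longrightarrow> (f has_real_derivative f' x) (at x)"
    and down: "\<And>x. a \<le> x \<Longrightarrow> x \<le> b \<Longrightarrow> f x = 0 \<Longrightarrow> f' x < 0"
  shows "f a > 0"
proof (rule ccontr)
  assume "\<not> f a > 0"
  then have fa: "f a \<le> 0" by simp
  \<comment> \<open>If \<open>f\<close> vanishes at \<open>b\<close>, it is positive just to the left of \<open>b\<close>, since it decreases there.\<close>
  obtain b' where b': "a < b'" "b' \<le> b" "f b' > 0"
  proof (cases "f b > 0")
    case True
    then show ?thesis using that assms(1) by blast
  next
    case False
    with assms(2) have f0: "f b = 0" by simp
    then have "f' b < 0" using down assms(1) by simp
    from DERIV_neg_dec_left[OF der this] assms(1)
    obtain d where d: "d > 0" "\<And>h. 0 < h \<Longrightarrow> h < d \<Longrightarrow> f b < f (b - h)"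
      by auto
    define h where "h = min (d / 2) ((b - a) / 2)"
    have "0 < h" "h < d" "h < b - a"
      using d(1) assms(1) by (auto simp: h_def min_def field_simps)
    then show ?thesis using that[of "b - h"] d(2)[of h] f0 by auto
  qed
  have cont: "continuous_on {a..b'} f"
    using der[THEN DERIV_isCont] b' by (auto intro!: continuous_at_imp_continuous_on)
  define S where "S = {x \<in> {a..b'}. f x \<le> 0}"
  have "closed S"
    unfolding S_def by (intro closed_Collect_le continuous_on_closed_Collect_le cont) auto
  moreover have "S \<noteq> {}" "bdd_above S"
    using fa b' by (auto simp: S_def intro!: exI[of _ a] bdd_aboveI[of _ b'])
  ultimately have sS: "Sup S \<in> S"
    by (intro closed_contains_Sup)
  define s where "s = Sup S"
  have s: "a \<le> s" "s \<le> b'" "f s \<le> 0"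
    using sS by (auto simp: S_def s_def)
  have "s < b'" using s b' by (cases "s = b'") auto
  have above: "f x > 0" if "s < x" "x \<le> b'" for x
  proof (rule ccontr)
    assume "\<not> f x > 0"
    then have "x \<in> S" using that s by (auto simp: S_def)
    then have "x \<le> s" unfolding s_def by (rule cSup_upper[OF _ \<open>bdd_above S\<close>])
    with that show False by simp
  qed
  have "f s = 0"
  proof (rule ccontr)
    assume "f s \<noteq> 0"
    with s have "f s < 0" by simp
    have "continuous_on {s..b'} f"
      using cont by (rule continuous_on_subset) (use s in auto)
    from IVT'[of f s 0 b', OF _ _ _ this] s b' \<open>f s < 0\<close>
    obtain x where "s \<le> x" "x \<le> b'" "f x = 0" by auto
    moreover from this \<open>f s < 0\<close> have "s < x" by (cases "s = x") auto
    ultimately show False using above[of x] by simp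
  qed
  then have "f' s < 0" using down s b' by simp
  from DERIV_neg_dec_right[OF der this] s b'
  obtain d where d: "d > 0" "\<And>h. 0 < h \<Longrightarrow> h < d \<Longrightarrow> f (s + h) < f s"
    by auto
  define h where "h = min (d / 2) (b' - s)"
  have "0 < h" "h < d" "s + h \<le> b'"
    using d(1) \<open>s < b'\<close> by (auto simp: h_def min_def)
  then show False using d(2)[of h] above[of "s + h"] \<open>f s = 0\<close> by simp
qed

text \<open>
  Where the two angles agree, the gap forces $\vartheta_2 - \vartheta_1$ to decrease, so if
  $\vartheta_2 \ge \vartheta_1$ somewhere, then $\vartheta_2 > \vartheta_1$ on the whole interval to
  the left. The singularity at $0$ excludes this: for small $\varrho$ the factor $k_1 - 1/\varrho$
  is negative and $\sin 2\vartheta$ increases near $\vartheta = \pi$, hence the positive difference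
  would be decreasing, although it tends to $0$ as $\varrho \to 0$.
\<close>

lemma solution_comparison:
  assumes s1: "solution k1 c1 \<theta>1" and s2: "solution k2 c2 \<theta>2"
    and l1: "(\<theta>1 \<longlongrightarrow> pi) (at_right 0)" and l2: "(\<theta>2 \<longlongrightarrow> pi) (at_right 0)"
    and gap: "\<bar>k1 - k2\<bar> < c1 - c2" and "\<rho> > 0"
  shows "\<theta>2 \<rho> < \<theta>1 \<rho>"
proof (rule ccontr)
  define D where "D = (\<lambda>x. \<theta>2 x - \<theta>1 x)"
  define D' where "D' = (\<lambda>x. (c2 - c1 + (k2 - k1) * sin (2 * \<theta>2 x)
      + (k1 - 1 / x) * (sin (2 * \<theta>2 x) - sin (2 * \<theta>1 x))) / x)"
  assume "\<not> \<theta>2 \<rho> < \<theta>1 \<rho>"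
  then have D\<rho>: "D \<rho> \<ge> 0" by (simp add: D_def)
  have der: "(D has_real_derivative D' x) (at x)" if "x > 0" for x
    unfolding D_def D'_def
    using s1 s2 that unfolding solution_iff_has_derivative
    by (auto intro!: derivative_eq_intros simp: field_simps)
  have forcing: "c2 - c1 + (k2 - k1) * sin t < 0" for t
  proof -
    have "\<bar>(k2 - k1) * sin t\<bar> \<le> \<bar>k2 - k1\<bar> * 1"
      unfolding abs_mult by (intro mult_left_mono) auto
    moreover have "\<bar>k2 - k1\<bar> = \<bar>k1 - k2\<bar>" by (rule abs_minus_commute)
    ultimately have "(k2 - k1) * sin t \<le> \<bar>k1 - k2\<bar>"
      by (metis abs_le_D1 mult.right_neutral)
    then show ?thesis using gap by argo
  qed
  \<comment> \<open>At a contact point the last summand in \<open>D'\<close> vanishes and only the forcing remains.\<close>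
  have "D' x < 0" if "x > 0" "D x = 0" for x
    using that forcing[of "2 * \<theta>2 x"] by (simp add: D_def D'_def divide_less_0_iff)
  then have pos: "D x > 0" if "0 < x" "x < \<rho>" for x
    using positive_before_downward_zeros[of x \<rho> D D'] that der D\<rho> by auto
  have near: "\<forall>\<^sub>F x in at_right 0. \<bar>\<theta> x - pi\<bar> < pi / 4"
    if "(\<theta> \<longlongrightarrow> pi) (at_right 0)" for \<theta> :: "real \<Rightarrow> real"
    using tendstoD[OF that, of "pi / 4"] by (simp add: dist_real_def)
  have "\<forall>\<^sub>F x in at_right (0::real). x < min \<rho> (1 / (\<bar>k1\<bar> + 1))"
    using \<open>\<rho> > 0\<close>
    by (intro eventually_at_rightI[of 0 "min \<rho> (1 / (\<bar>k1\<bar> + 1))"]) auto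
  from eventually_conj[OF this eventually_conj[OF near[OF l1] near[OF l2]]]
  obtain e where e: "e > 0" and en: "\<And>x. 0 < x \<Longrightarrow> x < e \<Longrightarrow>
      x < min \<rho> (1 / (\<bar>k1\<bar> + 1)) \<and> \<bar>\<theta>1 x - pi\<bar> < pi / 4 \<and> \<bar>\<theta>2 x - pi\<bar> < pi / 4"
    unfolding eventually_at_right_field by auto
  \<comment> \<open>Here \<open>e\<close> is so small that \<open>k1 - 1 / x\<close> is negative and both doubled angles lie on the
     increasing branch of the sine around \<open>2 * pi\<close>.\<close>
  have neg: "D' x < 0" if x: "0 < x" "x < e" for x
  proof -
    have "x * (\<bar>k1\<bar> + 1) < 1"
      using en[OF x] by (simp add: field_simps)
    then have "\<bar>k1\<bar> + 1 < 1 / x"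
      using x by (simp add: field_simps)
    then have "k1 < 1 / x" by linarith
    moreover have "sin (2 * \<theta>1 x) < sin (2 * \<theta>2 x)"
    proof -
      have "sin (2 * \<theta>1 x - 2 * pi) < sin (2 * \<theta>2 x - 2 * pi)"
        using en[OF x] pos[of x] x unfolding D_def abs_less_iff
        by (intro sin_monotone_2pi; simp; linarith)
      then show ?thesis by (simp add: sin_diff)
    qed
    ultimately have "(k1 - 1 / x) * (sin (2 * \<theta>2 x) - sin (2 * \<theta>1 x)) < 0"
      by (intro mult_neg_pos) auto
    then show ?thesis
      using forcing[of "2 * \<theta>2 x"] x by (simp add: D'_def divide_less_0_iff)
  qed
  have "(D \<longlongrightarrow> pi - pi) (at_right 0)"
    unfolding D_def by (intro tendsto_diff l1 l2)
  then have D0: "(D \<longlongrightarrow> 0) (at_right 0)" by simp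
  have "D (e / 2) \<le> 0"
  proof (rule tendsto_lowerbound[OF D0])
    have "D (e / 2) \<le> D x" if "0 < x" "x < e / 2" for x
    proof (intro less_imp_le DERIV_neg_imp_decreasing[of x])
      fix y assume "x \<le> y" "y \<le> e / 2"
      then have "0 < y" "y < e" using that by auto
      then show "\<exists>z. DERIV D y :> z \<and> z < 0" using der neg by blast
    qed (rule that(2))
    then show "\<forall>\<^sub>F x in at_right 0. D (e / 2) \<le> D x"
      using e unfolding eventually_at_right_field by (intro exI[of _ "e / 2"]) auto
  qed simp
  then show False using pos[of "e / 2"] en[of "e / 2"] e by simp
qed

lemma limit_comparison:
  assumes "is_theta_0 k1 c1 \<theta>1" "is_theta_0 k2 c2 \<theta>2" "\<bar>k1 - k2\<bar> < c1 - c2"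
    and "(\<theta>1 \<longlongrightarrow> a1) at_top" "(\<theta>2 \<longlongrightarrow> a2) at_top"
  shows "a2 \<le> a1"
proof (rule tendsto_le[OF _ assms(4,5)])
  show "\<forall>\<^sub>F x in at_top. \<theta>2 x \<le> \<theta>1 x"
    using eventually_gt_at_top[of 0]
    by eventually_elim
      (use assms solution_comparison[of k1 c1 \<theta>1 k2 c2 \<theta>2] in \<open>auto simp: is_theta_0_def less_imp_le\<close>)
qed simp

section \<open>The limit angle\<close>

text \<open>
  The rationalised quotient shows the monotonicity in $c$ at once and stays valid at $c = 0$, where
  the defining quotient is $0/0$.
\<close>

lemma theta_minus_alt:
  assumes "\<bar>c\<bar> \<le> k" "k > 0"
  shows "theta_minus c k = arctan (- c / (k + sqrt (k\<^sup>2 - c\<^sup>2)))"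
proof (cases "c = 0")
  case False
  have "c\<^sup>2 \<le> k\<^sup>2" using assms by (simp add: abs_le_square_iff[symmetric])
  then have "(k - sqrt (k\<^sup>2 - c\<^sup>2)) * (k + sqrt (k\<^sup>2 - c\<^sup>2)) = c\<^sup>2"
    by (simp add: algebra_simps power2_eq_square[symmetric])
  moreover have "k + sqrt (k\<^sup>2 - c\<^sup>2) > 0"
    using assms \<open>c\<^sup>2 \<le> k\<^sup>2\<close> by (simp add: add_pos_nonneg)
  ultimately have "(k - sqrt (k\<^sup>2 - c\<^sup>2)) / (- c) = - c / (k + sqrt (k\<^sup>2 - c\<^sup>2))"
    using False by (simp add: frac_eq_eq power2_eq_square)
  then show ?thesis by (simp add: theta_minus_def)
qed (simp add: theta_minus_def)

lemma theta_minus_strict_antimono: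
  assumes "- k \<le> c2" "c2 < c1" "c1 \<le> 0"
  shows "theta_minus c1 k < theta_minus c2 k"
proof -
  have k: "k > 0" using assms by linarith
  have "(- c1)\<^sup>2 \<le> (- c2)\<^sup>2" "(- c2)\<^sup>2 \<le> k\<^sup>2"
    using assms by (intro power_mono; linarith)+
  then have le: "c1\<^sup>2 \<le> c2\<^sup>2" "c2\<^sup>2 \<le> k\<^sup>2" by simp_all
  have "- c1 / (k + sqrt (k\<^sup>2 - c1\<^sup>2)) < - c2 / (k + sqrt (k\<^sup>2 - c2\<^sup>2))"
  proof (rule frac_less)
    show "0 < k + sqrt (k\<^sup>2 - c2\<^sup>2)" using k le by (intro add_pos_nonneg) auto
  qed (use assms le in auto)
  then show ?thesis
    using assms k by (simp add: theta_minus_alt arctan_less_iff)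
qed

definition candidate :: "real \<Rightarrow> nat \<Rightarrow> real" where
  "candidate k n = - sqrt (2 * k * real n - (real n)\<^sup>2)"

lemma candidate_bounds:
  assumes "real n \<le> k"
  shows "(candidate k n)\<^sup>2 = real n * (2 * k - real n)"
    and "k\<^sup>2 - (candidate k n)\<^sup>2 = (k - real n)\<^sup>2"
    and "- k \<le> candidate k n" and "candidate k n \<le> 0"
    and "n \<ge> 1 \<Longrightarrow> candidate k n < 0" and "real n < k \<Longrightarrow> - k < candidate k n"
proof -
  have "0 \<le> real n * (2 * k - real n)" using assms by simp
  moreover have eq: "2 * k * real n - (real n)\<^sup>2 = real n * (2 * k - real n)"
    by (simp add: power2_eq_square algebra_simps)
  ultimately have sq: "0 \<le> 2 * k * real n - (real n)\<^sup>2" by simp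
  show 1: "(candidate k n)\<^sup>2 = real n * (2 * k - real n)"
    using sq eq by (simp add: candidate_def)
  show 2: "k\<^sup>2 - (candidate k n)\<^sup>2 = (k - real n)\<^sup>2"
    unfolding 1 by (simp add: power2_eq_square algebra_simps)
  show "candidate k n \<le> 0" using sq by (simp add: candidate_def)
  have k: "k \<ge> 0" using assms of_nat_0_le_iff[of n] by linarith
  have "(- candidate k n)\<^sup>2 \<le> k\<^sup>2" using 2 zero_le_power2[of "k - real n"] by (simp only: power2_minus)
  then show "- k \<le> candidate k n" using k power2_le_imp_le[of "- candidate k n" k] by simp
  show "candidate k n < 0" if "n \<ge> 1"
  proof -
    have "0 < real n * (2 * k - real n)" using that assms by (intro mult_pos_pos) auto
    then show ?thesis unfolding candidate_def eq by simp
  qed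
  show "- k < candidate k n" if "real n < k"
  proof -
    have "0 < (k - real n)\<^sup>2" using that by simp
    then have "(- candidate k n)\<^sup>2 < k\<^sup>2" using 2 by (simp only: power2_minus)
    then show ?thesis using k power2_less_imp_less[of "- candidate k n" k] by simp
  qed
qed

lemma candidate_strict_antimono:
  assumes "m < n" "real n \<le> k"
  shows "candidate k n < candidate k m"
proof -
  have "0 < (real n - real m) * (2 * k - real n - real m)"
    using assms by (intro mult_pos_pos) auto
  then have "2 * k * real m - (real m)\<^sup>2 < 2 * k * real n - (real n)\<^sup>2"
    by (simp add: power2_eq_square algebra_simps)
  then show ?thesis by (simp add: candidate_def)
qed

lemma theta_minus_candidate:
  assumes "real n \<le> k"
  shows "theta_minus (candidate k n) k = arctan (real n / (- candidate k n))"
  using assms by (simp add: theta_minus_def candidate_bounds(2))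

section \<open>Polynomial solutions of the associated linear system\<close>

text \<open>
  Comparing coefficients in the equation for $U$ gives
  $2(j+1) q_{j+1} = (j-n)(2k-j-n) q_j$, because $c^2 = n(2k-n)$ makes $j^2 - 2kj + c^2$ factor as
  $(j-n)(j+n-2k)$. The recursion stops at $j = n$; the other factor does not vanish earlier since
  $j + n < 2n \le 2k$, so the degree is exactly $n$.
\<close>

lemma angle_polynomial_exists:
  fixes k :: real
  assumes "real n \<le> k"
  obtains Q :: "real poly" where "degree Q = n" "coeff Q 0 = 1"
    "[:0, 0, 1:] * pderiv (pderiv Q) + [:2, 1 - 2 * k:] * pderiv Q
       + smult (real n * (2 * k - real n)) Q = 0"
proof -
  define q where "q = (\<lambda>j. \<Prod>i<j. (real i - real n) * (2 * k - real i - real n) / (2 * (real i + 1)))"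
  define Q where "Q = (\<Sum>j\<le>n. monom (q j) j)"
  have q_Suc: "q (Suc j) * (2 * (real j + 1)) = q j * ((real j - real n) * (2 * k - real j - real n))" for j
    by (simp add: q_def add_pos_nonneg)
  have q0: "q j = 0" if "j > n" for j
    using that by (auto simp: q_def prod_zero_iff)
  have "q n \<noteq> 0"
    using assms by (auto simp: q_def prod_zero_iff)
  have cQ: "coeff Q j = q j" for j
    by (cases "j \<le> n") (auto simp: Q_def coeff_sum q0)
  have "degree Q = n"
    using \<open>q n \<noteq> 0\<close> q0 cQ by (intro antisym degree_le le_degree) auto
  moreover have "coeff Q 0 = 1" by (simp add: cQ q_def)
  moreover have "[:0, 0, 1:] * pderiv (pderiv Q) + [:2, 1 - 2 * k:] * pderiv Q
       + smult (real n * (2 * k - real n)) Q = 0" (is "?P = 0")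
  proof (rule poly_eqI)
    fix i
    have "coeff ?P i = q (Suc i) * (2 * (real i + 1))
        - q i * ((real i - real n) * (2 * k - real i - real n))"
    proof (cases i)
      case (Suc j)
      then show ?thesis
        by (cases j) (simp_all add: coeff_pderiv cQ algebra_simps)
    qed (simp add: coeff_pderiv cQ algebra_simps)
    then show "coeff ?P i = coeff 0 i" by (simp only: q_Suc) simp
  qed
  ultimately show thesis by (rule that)
qed

text \<open>
  This keeps the curve $(U,V)$ away from the origin. If $r$ were a multiple root, the orders of $Q$,
  $Q'$, $Q''$ at $r$ would be $m+2$, $m+1$, $m$, and the equation would equate a term of order $m$
  with terms of higher order, as $\varrho^2$ does not vanish at $r$.
\<close>

lemma angle_polynomial_simple_roots:
  fixes Q :: "real poly"
  assumes ode: "[:0, 0, 1:] * pderiv (pderiv Q) + A * pderiv Q + smult B Q = 0"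
    and "Q \<noteq> 0" "r > 0" "poly Q r = 0"
  shows "poly (pderiv Q) r \<noteq> 0"
proof
  assume r': "poly (pderiv Q) r = 0"
  have nonconst: "pderiv p \<noteq> 0" if "p \<noteq> 0" "poly p r = 0" for p :: "real poly"
    using that by (metis pderiv_eq_0_iff degree_eq_zeroE mult_zero_right pCons_0_0 poly_pCons
        add.right_neutral poly_0)
  have "pderiv Q \<noteq> 0" by (rule nonconst) fact+
  then have "pderiv (pderiv Q) \<noteq> 0" using r' by (rule nonconst)
  define m where "m = order r (pderiv (pderiv Q))"
  have o1: "order r (pderiv Q) = Suc m"
    unfolding m_def using \<open>pderiv Q \<noteq> 0\<close> r' by (rule order_pderiv)
  have o0: "order r Q = Suc (Suc m)"
    unfolding o1[symmetric] using assms(2,4) by (rule order_pderiv)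
  have d: "[:- r, 1:] ^ Suc m dvd Q" "[:- r, 1:] ^ Suc m dvd pderiv Q"
    using o0 o1 by (auto simp: order_divides simp del: power_Suc)
  have "[:0, 0, 1:] * pderiv (pderiv Q) = - (A * pderiv Q + smult B Q)"
    using ode by (simp add: eq_neg_iff_add_eq_0 add.assoc)
  moreover have "[:- r, 1:] ^ Suc m dvd - (A * pderiv Q + smult B Q)"
    using d by (simp only: dvd_minus_iff) (intro dvd_add dvd_mult dvd_smult)
  ultimately have dv: "[:- r, 1:] ^ Suc m dvd [:0, 0, 1:] * pderiv (pderiv Q)"
    by simp
  have nz: "[:0, 0, 1:] * pderiv (pderiv Q) \<noteq> 0"
    using \<open>pderiv (pderiv Q) \<noteq> 0\<close> by simp
  have "order r [:0, 0, 1:] = 0"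
    using assms by (intro order_0I) simp
  then have "order r ([:0, 0, 1:] * pderiv (pderiv Q)) = m"
    using order_mult[OF nz] by (simp add: m_def)
  with dv nz show False by (simp add: order_divides del: power_Suc)
qed

section \<open>Continuous angles of plane curves\<close>

text \<open>
  A differentiable polar angle, determined modulo $\pi$ only, is obtained by integrating the angular
  velocity $g = (UV' - VU')/(U^2+V^2)$ from a correct angle at $1$. The component of $(U,V)$
  orthogonal to the direction $(\cos\vartheta, \sin\vartheta)$ then satisfies a homogeneous linear
  equation and vanishes at $1$, hence everywhere.
\<close>

lemma angle_along_curve:
  fixes U V U' V' g :: "real \<Rightarrow> real"
  assumes U: "\<And>x. x > 0 \<Longrightarrow> (U has_real_derivative U' x) (at x)"
    and V: "\<And>x. x > 0 \<Longrightarrow> (V has_real_derivative V' x) (at x)"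
    and nz: "\<And>x. x > 0 \<Longrightarrow> (U x)\<^sup>2 + (V x)\<^sup>2 \<noteq> 0"
    and g: "\<And>x. x > 0 \<Longrightarrow> g x * ((U x)\<^sup>2 + (V x)\<^sup>2) = U x * V' x - V x * U' x"
    and cont: "continuous_on {0<..} g"
  obtains \<theta> where "\<And>x. x > 0 \<Longrightarrow> (\<theta> has_real_derivative g x) (at x)"
    "\<And>x. x > 0 \<Longrightarrow> V x * cos (\<theta> x) = U x * sin (\<theta> x)"
proof -
  have "\<exists>F. \<forall>x. 0 < ereal x \<longrightarrow> ereal x < \<infinity> \<longrightarrow> (F has_vector_derivative g x) (at x)"
    using cont by (intro einterval_antiderivative)
      (auto simp: continuous_on_eq_continuous_at zero_ereal_def)
  then obtain F where F: "\<And>x. x > 0 \<Longrightarrow> (F has_real_derivative g x) (at x)"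
    by (auto simp: has_real_derivative_iff_has_vector_derivative zero_ereal_def)
  obtain t where t: "V 1 * cos t = U 1 * sin t"
  proof (cases "U 1 = 0")
    case True
    then show ?thesis using that[of "pi / 2"] by simp
  next
    case False
    then show ?thesis using that[of "arctan (V 1 / U 1)"]
      by (simp add: cos_arctan sin_arctan)
  qed
  define \<theta> where "\<theta> = (\<lambda>x. F x - F 1 + t)"
  have \<theta>: "(\<theta> has_real_derivative g x) (at x)" if "x > 0" for x
    unfolding \<theta>_def using F[OF that] by (auto intro!: derivative_eq_intros)
  define E where "E = (\<lambda>x. (U x)\<^sup>2 + (V x)\<^sup>2)"
  define G where "G = (\<lambda>x. V x * cos (\<theta> x) - U x * sin (\<theta> x))"
  define h where "h = (\<lambda>x. U x * U' x + V x * V' x)"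
  have E: "(E has_real_derivative 2 * h x) (at x)" if "x > 0" for x
    unfolding E_def h_def using U[OF that] V[OF that]
    by (auto intro!: derivative_eq_intros)
  have G: "(G has_real_derivative h x / E x * G x) (at x)" if x: "x > 0" for x
  proof -
    have gx: "g x = (U x * V' x - V x * U' x) / E x"
      using g[OF x] nz[OF x] by (simp add: E_def field_simps)
    have Ex: "E x \<noteq> 0" using nz[OF x] by (simp add: E_def)
    have 1: "V' x - g x * U x = h x / E x * V x"
    proof -
      have "V' x * E x - (U x * V' x - V x * U' x) * U x = h x * V x"
        by (simp add: E_def h_def power2_eq_square algebra_simps)
      then show ?thesis using Ex unfolding gx by (simp add: field_simps)
    qed
    have 2: "U' x + g x * V x = h x / E x * U x"
    proof -
      have "U' x * E x + (U x * V' x - V x * U' x) * V x = h x * U x"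
        by (simp add: E_def h_def power2_eq_square algebra_simps)
      then show ?thesis using Ex unfolding gx by (simp add: field_simps)
    qed
    have "(G has_real_derivative (V' x - g x * U x) * cos (\<theta> x) - (U' x + g x * V x) * sin (\<theta> x)) (at x)"
      unfolding G_def using U[OF x] V[OF x] \<theta>[OF x]
      by (auto intro!: derivative_eq_intros simp: algebra_simps)
    moreover have "(V' x - g x * U x) * cos (\<theta> x) - (U' x + g x * V x) * sin (\<theta> x) = h x / E x * G x"
      unfolding 1 2 G_def by (simp add: algebra_simps)
    ultimately show ?thesis by simp
  qed
  \<comment> \<open>\<open>G\<close> and the square root of \<open>E\<close> have the same logarithmic derivative \<open>h / E\<close>.\<close>
  have const: "((\<lambda>x. (G x)\<^sup>2 / E x) has_real_derivative 0) (at x)" if x: "x > 0" for x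
  proof -
    have Ex: "E x \<noteq> 0" using nz[OF x] by (simp add: E_def)
    then show ?thesis
      using G[OF x] E[OF x]
      by (auto intro!: derivative_eq_intros simp: power2_eq_square)
  qed
  have "G x = 0" if x: "x > 0" for x
  proof -
    have "(G x)\<^sup>2 / E x = (G 1)\<^sup>2 / E 1"
      using has_field_derivative_0_imp_constant_on[of "{0<..}" "\<lambda>x. (G x)\<^sup>2 / E x"] const x
      by (auto simp: constant_on_def)
    also have "G 1 = 0" using t by (simp add: G_def \<theta>_def)
    finally have "(G x)\<^sup>2 / E x = 0" by simp
    moreover have "E x \<noteq> 0" using nz[OF x] by (simp add: E_def)
    ultimately show ?thesis by simp
  qed
  then show thesis using \<theta> by (intro that[of \<theta>]) (auto simp: G_def)
qed

lemma sin_double_of_direction: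
  fixes U V t :: real
  assumes "V * cos t = U * sin t" "U\<^sup>2 + V\<^sup>2 \<noteq> 0"
  shows "sin (2 * t) = 2 * U * V / (U\<^sup>2 + V\<^sup>2)"
proof -
  define R where "R = U * cos t + V * sin t"
  have "R * cos t = U * ((cos t)\<^sup>2 + (sin t)\<^sup>2)" "R * sin t = V * ((cos t)\<^sup>2 + (sin t)\<^sup>2)"
    unfolding R_def using assms(1) by algebra+
  then have UV: "U = R * cos t" "V = R * sin t" by simp_all
  have "U\<^sup>2 + V\<^sup>2 = R\<^sup>2"
    unfolding UV power_mult_distrib distrib_left[symmetric] by simp
  moreover have "2 * U * V = R\<^sup>2 * sin (2 * t)"
    unfolding UV by (simp add: sin_double power2_eq_square)
  ultimately show ?thesis using assms(2) by simp
qed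

text \<open>
  The sine determines the angle only up to reflections and half-turns, but where the cosine has no
  zero a continuous angle stays between two consecutive odd multiples of $\pi/2$; there it is
  recovered by the arc sine.
\<close>

lemma angle_converges:
  fixes f :: "real \<Rightarrow> real"
  assumes cont: "continuous_on I f" "connected I"
    and F: "F \<noteq> bot" and I: "\<forall>\<^sub>F x in F. x \<in> I"
    and cos: "\<And>x. x \<in> I \<Longrightarrow> cos (f x) \<noteq> 0"
    and lim: "((\<lambda>x. sin (f x)) \<longlongrightarrow> 0) F"
  obtains j :: int where "(f \<longlongrightarrow> of_int j * pi) F"
proof -
  obtain x0 where x0: "x0 \<in> I" using I F eventually_happens by blast
  define j where "j = \<lfloor>f x0 / pi + 1 / 2\<rfloor>"
  have endpoint: "cos (of_int i * pi - pi / 2) = 0" for i :: int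
    by (simp add: cos_diff sin_integer_2pi sin_zero_iff_int2)
  have conn: "connected (f ` I)" by (rule connected_continuous_image[OF cont])
  have no: "of_int i * pi - pi / 2 \<notin> f ` I" for i :: int
    using cos endpoint by (metis imageE)
  have "of_int j \<le> f x0 / pi + 1 / 2" "f x0 / pi + 1 / 2 < of_int j + 1"
    unfolding j_def by linarith+
  then have f0: "of_int j * pi - pi / 2 \<le> f x0" "f x0 < of_int (j + 1) * pi - pi / 2"
    by (simp_all add: field_simps)
  have range: "of_int j * pi - pi / 2 < f x" "f x < of_int (j + 1) * pi - pi / 2" if "x \<in> I" for x
  proof -
    have "\<not> f x \<le> of_int j * pi - pi / 2"
      using connected_contains_Icc[OF conn, of "f x" "f x0"] no[of j] f0 that x0
      by (auto simp: subset_iff)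
    moreover have "\<not> of_int (j + 1) * pi - pi / 2 \<le> f x"
      using connected_contains_Icc[OF conn, of "f x0" "f x"] no[of "j + 1"] f0 that x0
      by (auto simp: subset_iff)
    ultimately show "of_int j * pi - pi / 2 < f x" "f x < of_int (j + 1) * pi - pi / 2" by auto
  qed
  have sj: "sin (of_int j * pi) = 0" by (simp add: sin_zero_iff_int2)
  have "((\<lambda>x. sin (f x) * cos (of_int j * pi)) \<longlongrightarrow> 0 * cos (of_int j * pi)) F"
    by (intro tendsto_intros lim)
  then have "((\<lambda>x. sin (f x - of_int j * pi)) \<longlongrightarrow> 0) F"
    by (simp add: sin_diff sj)
  then have "((\<lambda>x. arcsin (sin (f x - of_int j * pi))) \<longlongrightarrow> arcsin 0) F"
    by (intro isCont_tendsto_compose[OF isCont_arcsin]) auto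
  moreover have "\<forall>\<^sub>F x in F. arcsin (sin (f x - of_int j * pi)) = f x - of_int j * pi"
    using I
  proof eventually_elim
    case (elim x)
    show ?case using range[OF elim] by (intro arcsin_sin) (auto simp: field_simps)
  qed
  ultimately have "((\<lambda>x. f x - of_int j * pi) \<longlongrightarrow> 0) F"
    by (simp add: tendsto_cong)
  then have "((\<lambda>x. f x - of_int j * pi + of_int j * pi) \<longlongrightarrow> 0 + of_int j * pi) F"
    by (intro tendsto_intros)
  then show thesis by (intro that[of j]) simp
qed

text \<open>
  With $\beta = \arctan T$ one has
  $\sin(\vartheta - \beta) = (V/U - T)\cos\vartheta\cos\beta$, which tends to $0$.
\<close>

lemma angle_limit_of_slope:
  assumes F: "F = at_right (0::real) \<or> F = at_top"
    and cont: "continuous_on {0<..} \<theta>"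
    and dir: "\<And>x. x > 0 \<Longrightarrow> V x * cos (\<theta> x) = U x * sin (\<theta> x)"
    and U: "\<forall>\<^sub>F x in F. U x \<noteq> 0"
    and lim: "((\<lambda>x. V x / U x) \<longlongrightarrow> T) F"
  obtains j :: int where "(\<theta> \<longlongrightarrow> arctan T + of_int j * pi) F"
proof -
  define \<beta> where "\<beta> = arctan T"
  have pos: "\<forall>\<^sub>F x in F. 0 < x"
    using F eventually_gt_at_top[of 0] eventually_at_right_less[of 0] by auto
  have nb: "F \<noteq> bot"
    using F trivial_limit_at_right_real[of 0] trivial_limit_at_top_linorder by metis
  have sb: "sin \<beta> = T * cos \<beta>" by (simp add: \<beta>_def sin_arctan cos_arctan)
  have "((\<lambda>x. V x / U x - T) \<longlongrightarrow> 0) F"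
    using lim by (simp add: LIM_zero)
  then have "((\<lambda>x. (V x / U x - T) * (cos (\<theta> x) * cos \<beta>)) \<longlongrightarrow> 0) F"
  proof (rule tendsto_0_le[where K = 1])
    show "\<forall>\<^sub>F x in F. norm ((V x / U x - T) * (cos (\<theta> x) * cos \<beta>)) \<le> norm (V x / U x - T) * 1"
      unfolding norm_mult
      by (intro always_eventually allI mult_left_mono) (auto intro: mult_le_one)
  qed
  moreover have "\<forall>\<^sub>F x in F. (V x / U x - T) * (cos (\<theta> x) * cos \<beta>) = sin (\<theta> x - \<beta>)"
    using pos U
  proof eventually_elim
    case (elim x)
    then have "sin (\<theta> x) = V x / U x * cos (\<theta> x)"
      using dir[of x] by (simp add: field_simps)
    then show ?case by (simp add: sin_diff sb algebra_simps)
  qed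
  ultimately have lim0: "((\<lambda>x. sin (\<theta> x - \<beta>)) \<longlongrightarrow> 0) F"
    by (rule Lim_transform_eventually)
  from tendstoD[OF this, of 1]
  have "\<forall>\<^sub>F x in F. 0 < x \<and> \<bar>sin (\<theta> x - \<beta>)\<bar> < 1"
    using pos by (auto simp: eventually_conj_iff)
  then obtain I where I: "connected I" "\<forall>\<^sub>F x in F. x \<in> I"
    "\<And>x. x \<in> I \<Longrightarrow> 0 < x \<and> \<bar>sin (\<theta> x - \<beta>)\<bar> < 1"
  proof (cases "F = at_top")
    case True
    assume ev: "\<forall>\<^sub>F x in F. 0 < x \<and> \<bar>sin (\<theta> x - \<beta>)\<bar> < 1"
    then obtain M where "\<And>x. x > M \<Longrightarrow> 0 < x \<and> \<bar>sin (\<theta> x - \<beta>)\<bar> < 1"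
      using True by (auto simp: eventually_at_top_dense)
    then show ?thesis
      using True by (intro that[of "{M<..}"]) (auto simp: eventually_gt_at_top)
  next
    case False
    assume ev: "\<forall>\<^sub>F x in F. 0 < x \<and> \<bar>sin (\<theta> x - \<beta>)\<bar> < 1"
    have F0: "F = at_right 0" using F False by simp
    with ev obtain e where "e > 0" "\<And>x. 0 < x \<Longrightarrow> x < e \<Longrightarrow> 0 < x \<and> \<bar>sin (\<theta> x - \<beta>)\<bar> < 1"
      by (auto simp: eventually_at_right_field)
    then show ?thesis
      using F0 by (intro that[of "{0<..<e}"]) (auto simp: eventually_at_right_field)
  qed
  obtain j :: int where "((\<lambda>x. \<theta> x - \<beta>) \<longlongrightarrow> of_int j * pi) F"
  proof (rule angle_converges[of I "\<lambda>x. \<theta> x - \<beta>" F])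
    show "continuous_on I (\<lambda>x. \<theta> x - \<beta>)"
      using I(3) by (intro continuous_intros continuous_on_subset[OF cont]) auto
    show "cos (\<theta> x - \<beta>) \<noteq> 0" if "x \<in> I" for x
    proof -
      have "(sin (\<theta> x - \<beta>))\<^sup>2 < 1" using I(3)[OF that] by (simp add: abs_square_less_1)
      then have "0 < (cos (\<theta> x - \<beta>))\<^sup>2"
        using sin_cos_squared_add[of "\<theta> x - \<beta>"] by linarith
      then show ?thesis by auto
    qed
  qed (use I nb lim0 in auto)
  then have "((\<lambda>x. \<theta> x - \<beta> + \<beta>) \<longlongrightarrow> of_int j * pi + \<beta>) F"
    by (intro tendsto_intros)
  then show thesis by (intro that[of j]) (simp add: \<beta>_def add.commute)
qed

text \<open>The limit is the growth exponent of $Q$; it fixes the slope $V/U$ at infinity.\<close>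

lemma poly_log_derivative_at_top:
  fixes Q :: "real poly"
  assumes "degree Q \<noteq> 0"
  shows "((\<lambda>x. x * poly (pderiv Q) x / poly Q x) \<longlongrightarrow> real (degree Q)) at_top"
proof -
  define n where "n = degree Q"
  have n: "n \<noteq> 0" "Q \<noteq> 0" using assms by (auto simp: n_def)
  define P where "P = pCons 0 (pderiv Q)"
  have "pderiv Q \<noteq> 0" using assms by (simp add: pderiv_eq_0_iff)
  then have dP: "degree P = n" using n by (simp add: P_def degree_pderiv n_def)
  have lP: "coeff P n = real n * coeff Q n"
    using n by (cases n) (simp_all add: P_def coeff_pderiv)
  have lead: "((\<lambda>x. poly p x / x ^ degree p) \<longlongrightarrow> coeff p (degree p)) at_top" for p :: "real poly"
    using poly_divide_tendsto_aux[of p] tendsto_mono[OF at_top_le_at_infinity] by blast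
  have "((\<lambda>x. (poly P x / x ^ n) / (poly Q x / x ^ n)) \<longlongrightarrow> coeff P n / coeff Q n) at_top"
    using lead[of P] lead[of Q] n by (intro tendsto_divide) (auto simp: dP n_def[symmetric], simp add: n_def)
  moreover have "coeff P n / coeff Q n = real n" using n by (simp add: lP) (simp add: n_def)
  moreover have "\<forall>\<^sub>F x in at_top. (poly P x / x ^ n) / (poly Q x / x ^ n) = x * poly (pderiv Q) x / poly Q x"
    using eventually_gt_at_top[of 0] by eventually_elim (simp add: P_def)
  ultimately show ?thesis
    using Lim_transform_eventually n_def by fastforce
qed

section \<open>Solutions at the exceptional values and their indices\<close>

text \<open>
  The bound on the index comes from counting zeros: on its way from $\pi$ to $\vartheta_- - m\pi$
  the angle takes the $m + 1$ values $\pi/2 - i\pi$ with $0 \le i \le m$, and the points where it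
  does so are distinct zeros of $U = Q$, a polynomial of degree $n$.
\<close>

lemma candidate_solution:
  assumes "n \<ge> 1" "real n \<le> k"
  obtains \<theta> and m :: int where "is_theta_0 k (candidate k n) \<theta>"
    "(\<theta> \<longlongrightarrow> theta_minus (candidate k n) k - of_int m * pi) at_top" "m < int n"
proof -
  define c where "c = candidate k n"
  have c: "c < 0" "c\<^sup>2 = real n * (2 * k - real n)"
    using candidate_bounds(1,5)[OF assms(2)] assms(1) by (auto simp: c_def)
  obtain Q :: "real poly" where Q: "degree Q = n" "coeff Q 0 = 1" and
    ode: "[:0, 0, 1:] * pderiv (pderiv Q) + [:2, 1 - 2 * k:] * pderiv Q
       + smult (real n * (2 * k - real n)) Q = 0"
    by (rule angle_polynomial_exists[OF assms(2)])
  have "Q \<noteq> 0" using Q by auto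
  have ode': "x\<^sup>2 * poly (pderiv (pderiv Q)) x + (2 + (1 - 2 * k) * x) * poly (pderiv Q) x
      + c\<^sup>2 * poly Q x = 0" for x
    unfolding c(2) using arg_cong[OF ode, of "\<lambda>p. poly p x"]
    by (simp add: power2_eq_square algebra_simps)
  define U where "U = (\<lambda>x. poly Q x)"
  define V where "V = (\<lambda>x. - x * poly (pderiv Q) x / c)"
  define U' where "U' = (\<lambda>x. poly (pderiv Q) x)"
  define V' where "V' = (\<lambda>x. - (poly (pderiv Q) x + x * poly (pderiv (pderiv Q)) x) / c)"
  define g where "g = (\<lambda>x. (c + (k - 1 / x) * (2 * U x * V x / ((U x)\<^sup>2 + (V x)\<^sup>2))) / x)"
  have nz: "(U x)\<^sup>2 + (V x)\<^sup>2 \<noteq> 0" if "x > 0" for x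
    using angle_polynomial_simple_roots[OF ode \<open>Q \<noteq> 0\<close> that] that c(1)
    by (auto simp: U_def V_def sum_power2_eq_zero_iff)
  \<comment> \<open>The first-order system for \<open>(U, V)\<close>, cleared of denominators.\<close>
  have U'_eq: "x * U' x = - c * V x" for x
    using c(1) by (simp add: U'_def V_def)
  have V'_eq: "x * x * V' x = x * c * U x + 2 * (k * x - 1) * V x" for x
  proof -
    have "c * (x * x * V' x) = - x * (x\<^sup>2 * poly (pderiv (pderiv Q)) x + x * poly (pderiv Q) x)"
    proof -
      have "c * V' x = - (poly (pderiv Q) x + x * poly (pderiv (pderiv Q)) x)"
        using c(1) by (simp add: V'_def)
      then show ?thesis by algebra
    qed
    also have "\<dots> = x * (c\<^sup>2 * poly Q x) - 2 * (k * x - 1) * x * poly (pderiv Q) x"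
      using ode'[of x] by algebra
    also have "\<dots> = c * (x * c * U x + 2 * (k * x - 1) * V x)"
      using c(1) by (simp add: U_def V_def power2_eq_square algebra_simps)
    finally show ?thesis using c(1) by simp
  qed
  obtain \<theta>' where \<theta>': "\<And>x. x > 0 \<Longrightarrow> (\<theta>' has_real_derivative g x) (at x)"
    and dir: "\<And>x. x > 0 \<Longrightarrow> V x * cos (\<theta>' x) = U x * sin (\<theta>' x)"
  proof (rule angle_along_curve[of U U' V V' g])
    show "(U has_real_derivative U' x) (at x)" for x
      unfolding U_def U'_def by (rule poly_DERIV)
    show "(V has_real_derivative V' x) (at x)" for x
      unfolding V_def V'_def using c(1)
      by (auto intro!: derivative_eq_intros simp: field_simps)
    show "g x * ((U x)\<^sup>2 + (V x)\<^sup>2) = U x * V' x - V x * U' x" if x: "x > 0" for x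
    proof -
      have "x * x * (g x * ((U x)\<^sup>2 + (V x)\<^sup>2))
          = x * c * ((U x)\<^sup>2 + (V x)\<^sup>2) + 2 * (k * x - 1) * U x * V x"
      proof -
        have "g x * ((U x)\<^sup>2 + (V x)\<^sup>2) = (c * ((U x)\<^sup>2 + (V x)\<^sup>2) + (k - 1 / x) * (2 * U x * V x)) / x"
          using nz[OF x] by (simp add: g_def distrib_right)
        then show ?thesis
          using x by (simp add: distrib_left right_diff_distrib left_diff_distrib diff_divide_distrib add_divide_distrib)
      qed
      also have "\<dots> = x * x * (U x * V' x - V x * U' x)"
        using U'_eq[of x] V'_eq[of x] by algebra
      finally show ?thesis using x by simp
    qed
    show "continuous_on {0<..} g"
      unfolding g_def U_def V_def using nz[unfolded U_def V_def] c(1)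
      by (intro continuous_intros ballI; simp)
  qed (use nz in auto)
  have sol': "solution k c \<theta>'"
    unfolding solution_iff_has_derivative
  proof (intro allI impI)
    fix x :: real assume x: "x > 0"
    show "(\<theta>' has_real_derivative (c + (k - 1 / x) * sin (2 * \<theta>' x)) / x) (at x)"
      using \<theta>'[OF x] unfolding sin_double_of_direction[OF dir[OF x] nz[OF x]] g_def .
  qed
  have "((\<lambda>x. V x / U x) \<longlongrightarrow> - 0 * poly (pderiv Q) 0 / c / poly Q 0) (at_right 0)"
    unfolding U_def V_def
    by (intro tendsto_intros) (use c Q in \<open>auto simp: poly_0_coeff_0\<close>)
  then have V0: "((\<lambda>x. V x / U x) \<longlongrightarrow> 0) (at_right 0)" by simp
  have "(U \<longlongrightarrow> poly Q 0) (at_right 0)"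
    unfolding U_def by (intro tendsto_intros)
  then have U0: "\<forall>\<^sub>F x in at_right 0. U x \<noteq> 0"
    by (rule tendsto_imp_eventually_ne) (simp add: Q poly_0_coeff_0)
  obtain j0 :: int where j0: "(\<theta>' \<longlongrightarrow> arctan 0 + of_int j0 * pi) (at_right 0)"
    by (rule angle_limit_of_slope[OF _ solution_continuous_on[OF sol'] dir U0 V0]) auto
  \<comment> \<open>Shift by a multiple of \<open>pi\<close> so that the limit at 0 becomes \<open>pi\<close>.\<close>
  define \<theta> where "\<theta> = (\<lambda>x. \<theta>' x + of_int (1 - j0) * pi)"
  have sol: "solution k c \<theta>" unfolding \<theta>_def by (rule solution_shift[OF sol'])
  have "(\<theta> \<longlongrightarrow> arctan 0 + of_int j0 * pi + of_int (1 - j0) * pi) (at_right 0)"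
    unfolding \<theta>_def by (intro tendsto_intros j0)
  then have \<theta>0: "(\<theta> \<longlongrightarrow> pi) (at_right 0)" by (simp add: algebra_simps)
  have "((\<lambda>x. - (x * poly (pderiv Q) x / poly Q x) / c) \<longlongrightarrow> - real n / c) at_top"
    using poly_log_derivative_at_top[of Q] Q(1) assms(1) c(1) by (intro tendsto_intros) auto
  then have Vinf: "((\<lambda>x. V x / U x) \<longlongrightarrow> real n / (- c)) at_top"
    by (simp add: U_def V_def field_simps)
  have Uinf: "\<forall>\<^sub>F x in at_top. U x \<noteq> 0"
  proof -
    have "\<forall>\<^sub>F x in at_top. x * poly (pderiv Q) x / poly Q x \<noteq> 0"
      using poly_log_derivative_at_top[of Q] Q(1) assms(1)
      by (intro tendsto_imp_eventually_ne) auto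
    then show ?thesis by (rule eventually_mono) (auto simp: U_def)
  qed
  obtain j1 :: int where j1: "(\<theta>' \<longlongrightarrow> arctan (real n / (- c)) + of_int j1 * pi) at_top"
    by (rule angle_limit_of_slope[OF _ solution_continuous_on[OF sol'] dir Uinf Vinf]) auto
  define m where "m = j0 - 1 - j1"
  have "(\<theta> \<longlongrightarrow> arctan (real n / (- c)) + of_int j1 * pi + of_int (1 - j0) * pi) at_top"
    unfolding \<theta>_def by (intro tendsto_intros j1)
  moreover have "arctan (real n / (- c)) + of_int j1 * pi + of_int (1 - j0) * pi
      = theta_minus c k - of_int m * pi"
    using theta_minus_candidate[OF assms(2)] by (simp add: c_def m_def algebra_simps)
  ultimately have lim: "(\<theta> \<longlongrightarrow> theta_minus c k - of_int m * pi) at_top" by simp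
  have "m < int n"
  proof (cases "m < 0")
    case False
    define M where "M = nat m"
    have M: "m = int M" using False by (simp add: M_def)
    have "\<exists>x>0. \<theta> x = pi / 2 - real i * pi" if "i \<le> M" for i
    proof -
      define v where "v = pi / 2 - real i * pi"
      have "real i * pi \<le> real M * pi" using that by simp
      moreover have "theta_minus c k < pi / 2" unfolding theta_minus_def by (rule arctan_ubound)
      ultimately have "theta_minus c k - of_int m * pi < v"
        unfolding v_def M of_int_of_nat_eq by linarith
      from order_tendstoD(2)[OF lim this]
      obtain b where b: "b > 0" "\<theta> b < v"
        using eventually_happens[OF eventually_conj[OF _ eventually_gt_at_top[of 0]]] by force
      have "v < pi" using pi_gt_zero mult_nonneg_nonneg[of "real i" pi] unfolding v_def by linarith
      from order_tendstoD(1)[OF \<theta>0 this]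
      obtain e where e: "e > 0" "\<And>x. 0 < x \<Longrightarrow> x < e \<Longrightarrow> v < \<theta> x"
        by (auto simp: eventually_at_right_field)
      define a where "a = min (e / 2) b"
      have a: "0 < a" "a \<le> b" "a < e" using e b by (auto simp: a_def)
      have "continuous_on {a..b} \<theta>"
        by (rule continuous_on_subset[OF solution_continuous_on[OF sol]]) (use a in auto)
      from IVT2'[OF _ _ a(2) this, of v] b e(2)[OF a(1,3)]
      obtain x where "a \<le> x" "\<theta> x = v" by auto
      then show ?thesis using a(1) unfolding v_def[symmetric] by (intro exI[of _ x]) simp
    qed
    then obtain X where X: "\<And>i. i \<le> M \<Longrightarrow> X i > 0 \<and> \<theta> (X i) = pi / 2 - real i * pi"
      by metis
    have "inj_on X {..M}"
    proof (rule inj_onI)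
      fix i j assume "i \<in> {..M}" "j \<in> {..M}" "X i = X j"
      then have "pi / 2 - real i * pi = pi / 2 - real j * pi" using X by (metis atMost_iff)
      then show "i = j" by simp
    qed
    moreover have "X ` {..M} \<subseteq> {x. poly Q x = 0}"
    proof clarify
      fix i assume i: "i \<le> M"
      define x where "x = X i"
      have x: "x > 0" using X i by (simp add: x_def)
      have "\<theta>' x = pi / 2 + of_int (j0 - 1 - int i) * pi"
        using X[OF i] by (simp add: \<theta>_def x_def algebra_simps)
      moreover have "sin (of_int (j0 - 1 - int i) * pi) = 0"
        using sin_zero_iff_int2 by blast
      ultimately have "cos (\<theta>' x) = 0"
        by (simp only: cos_add cos_pi_half sin_pi_half)
      moreover from this have "sin (\<theta>' x) \<noteq> 0"
        using sin_cos_squared_add[of "\<theta>' x"] by auto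
      ultimately have "U x = 0" using dir[OF x] by simp
      then show "poly Q (X i) = 0" by (simp add: U_def x_def)
    qed
    ultimately have "card {..M} \<le> card {x. poly Q x = 0}"
      using poly_roots_finite[OF \<open>Q \<noteq> 0\<close>] by (metis card_image card_mono)
    also have "\<dots> \<le> n" using card_poly_roots_bound[OF \<open>Q \<noteq> 0\<close>] Q by simp
    finally show ?thesis by (simp add: M)
  qed simp
  then show thesis using that sol \<theta>0 lim unfolding c_def[symmetric] by (auto simp: is_theta_0_def)
qed

text \<open>
  The comparison orders the limits only weakly; strictness comes from $\vartheta_-$, which is larger
  for the smaller $c$.
\<close>

lemma index_strict_mono:
  assumes "is_theta_0 k c1 \<theta>1" "is_theta_0 k c2 \<theta>2"
    and "(\<theta>1 \<longlongrightarrow> theta_minus c1 k - of_int m1 * pi) at_top"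
    and "(\<theta>2 \<longlongrightarrow> theta_minus c2 k - of_int m2 * pi) at_top"
    and "- k \<le> c2" "c2 < c1" "c1 \<le> 0"
  shows "m1 < m2"
proof -
  have "theta_minus c2 k - of_int m2 * pi \<le> theta_minus c1 k - of_int m1 * pi"
    using assms by (intro limit_comparison[OF assms(1,2) _ assms(3,4)]) auto
  also have "\<dots> < theta_minus c2 k - of_int m1 * pi"
    using theta_minus_strict_antimono[OF assms(5-7)] by simp
  finally have "of_int m1 * pi < of_int m2 * pi" by simp
  then show ?thesis by simp
qed

text \<open>
  Induction along $n$: strict monotonicity raises the index by at least one in each step, and the
  count of zeros allows no more. The induction starts at $n = 0$, $c = 0$ with the constant solution
  $\pi$, whose index is $-1$ because $\vartheta_- = 0$ there; the case $n = k$, $c = -k$ is included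
  since it provides the barrier for \<open>exceptional_index\<close>.
\<close>

lemma candidate_index:
  assumes "k > 0" "real n \<le> k"
  obtains \<theta> where "is_theta_0 k (candidate k n) \<theta>"
    "(\<theta> \<longlongrightarrow> theta_minus (candidate k n) k - (real n - 1) * pi) at_top"
proof -
  have "\<exists>\<theta>. is_theta_0 k (candidate k n) \<theta> \<and>
      (\<theta> \<longlongrightarrow> theta_minus (candidate k n) k - of_int (int n - 1) * pi) at_top"
    using assms(2)
  proof (induction n)
    case 0
    show ?case
      by (intro exI[of _ "\<lambda>_. pi"])
        (simp add: is_theta_0_def solution_def candidate_def theta_minus_def)
  next
    case (Suc n)
    then have n: "real n \<le> k" by simp
    with Suc.IH obtain \<phi> where \<phi>: "is_theta_0 k (candidate k n) \<phi>"
      "(\<phi> \<longlongrightarrow> theta_minus (candidate k n) k - of_int (int n - 1) * pi) at_top"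
      by blast
    obtain \<theta> m where \<theta>: "is_theta_0 k (candidate k (Suc n)) \<theta>"
      "(\<theta> \<longlongrightarrow> theta_minus (candidate k (Suc n)) k - of_int m * pi) at_top" "m < int (Suc n)"
      using candidate_solution[OF _ Suc.prems] by auto
    have "int n - 1 < m"
    proof (rule index_strict_mono[OF \<phi>(1) \<theta>(1) \<phi>(2) \<theta>(2)])
      show "- k \<le> candidate k (Suc n)" by (rule candidate_bounds(3)[OF Suc.prems])
      show "candidate k n \<le> 0" by (rule candidate_bounds(4)[OF n])
      show "candidate k (Suc n) < candidate k n"
        using Suc.prems by (intro candidate_strict_antimono) auto
    qed
    with \<theta>(3) have "m = int (Suc n) - 1" by simp
    with \<theta> show ?case by blast
  qed
  then show thesis using that by auto
qed

text \<open>
  The index alone identifies an exceptional value. It is confined to $0 \le m$ and $m + 1 < k$ by the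
  constant solution above and the barrier with parameters $(N,-N)$, $N = \lceil k\rceil$, below;
  then the value belonging to $n = m + 1$ has the same index and must coincide with $c$. The index is
  an integer here because the definition of exceptional values allows any multiple of $\pi$.
\<close>

lemma exceptional_index:
  assumes k: "k > 0" and c: "- k < c" "c < 0"
    and \<theta>: "is_theta_0 k c \<theta>" "(\<theta> \<longlongrightarrow> theta_minus c k - of_int m * pi) at_top"
  obtains n :: nat where "1 \<le> n" "real n < k" "m = int n - 1" "c = candidate k n"
proof -
  have tm: "0 < theta_minus c k" "theta_minus c k < pi / 4"
    using theta_minus_unique[OF c] by blast+
  obtain \<phi>0 where \<phi>0: "is_theta_0 k (candidate k 0) \<phi>0"
    "(\<phi>0 \<longlongrightarrow> theta_minus (candidate k 0) k - (real 0 - 1) * pi) at_top"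
    by (rule candidate_index[of k 0]) (use k in auto)
  have "-1 < m"
    using index_strict_mono[OF \<phi>0(1) \<theta>(1), of "-1" m] \<phi>0(2) \<theta>(2) c by (simp add: candidate_def)
  define n where "n = nat (m + 1)"
  have n: "n \<ge> 1" "m = int n - 1" using \<open>-1 < m\<close> by (auto simp: n_def)
  define N where "N = nat \<lceil>k\<rceil>"
  have N: "k \<le> real N" "real N < k + 1" using k unfolding N_def by linarith+
  obtain \<psi> where \<psi>: "is_theta_0 (real N) (candidate (real N) N) \<psi>"
    "(\<psi> \<longlongrightarrow> theta_minus (candidate (real N) N) (real N) - (real N - 1) * pi) at_top"
    by (rule candidate_index[of "real N" N]) (use N k in auto)
  have barrier: "candidate (real N) N = - real N" "theta_minus (- real N) (real N) = pi / 4"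
    using N k by (auto simp: candidate_def theta_minus_def arctan_one power2_eq_square)
  \<comment> \<open>\<open>c > - k\<close> is exactly the gap condition between \<open>(k, c)\<close> and \<open>(N, - N)\<close>.\<close>
  have "pi / 4 - (real N - 1) * pi \<le> theta_minus c k - of_int m * pi"
    using \<psi> N c unfolding barrier by (intro limit_comparison[OF \<theta>(1) _ _ \<theta>(2)]) auto
  then have "of_int m * pi < (real N - 1) * pi" using tm by linarith
  then have "n < N" unfolding n(2) by simp
  then have nk: "real n < k" using N by linarith
  obtain \<phi> where \<phi>: "is_theta_0 k (candidate k n) \<phi>"
    "(\<phi> \<longlongrightarrow> theta_minus (candidate k n) k - (real n - 1) * pi) at_top"
    by (rule candidate_index[of k n]) (use k nk in auto)
  then have \<phi>m: "(\<phi> \<longlongrightarrow> theta_minus (candidate k n) k - of_int m * pi) at_top"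
    by (simp add: n(2))
  have "\<not> c < candidate k n"
    using index_strict_mono[OF \<phi>(1) \<theta>(1) \<phi>m \<theta>(2)] candidate_bounds(4)[of n k] nk c by auto
  moreover have "\<not> candidate k n < c"
    using index_strict_mono[OF \<theta>(1) \<phi>(1) \<theta>(2) \<phi>m] candidate_bounds(3)[of n k] nk c by auto
  ultimately have "c = candidate k n" by simp
  then show thesis using that n nk by blast
qed

lemma candidate_is_exceptional:
  assumes "n \<ge> 1" "real n < k"
  shows "exceptional_value_with_index k (n - 1) (candidate k n)"
proof -
  have k: "k > 0" "real n \<le> k" using assms by linarith+
  obtain \<theta> where \<theta>: "is_theta_0 k (candidate k n) \<theta>"
    "(\<theta> \<longlongrightarrow> theta_minus (candidate k n) k - (real n - 1) * pi) at_top"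
    by (rule candidate_index[OF k])
  define \<phi> where "\<phi> = (\<lambda>x. \<theta> x + of_int (int n - 1) * pi)"
  have "(\<phi> \<longlongrightarrow> theta_minus (candidate k n) k - (real n - 1) * pi + of_int (int n - 1) * pi) at_top"
    unfolding \<phi>_def by (intro tendsto_intros \<theta>)
  then have "is_theta_infinity k (candidate k n) \<phi>"
    using \<theta>(1) solution_shift[of k "candidate k n" \<theta> "int n - 1"]
    unfolding \<phi>_def is_theta_infinity_def is_theta_0_def by simp
  moreover have "\<forall>x>0. \<theta> x = \<phi> x + of_int (1 - int n) * pi"
    by (simp add: \<phi>_def algebra_simps)
  ultimately have "exceptional_value k (candidate k n)"
    using \<theta>(1) candidate_bounds(5,6)[OF k(2)] assms unfolding exceptional_value_def by blast
  then show ?thesis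
    using \<theta> assms(1) unfolding exceptional_value_with_index_def by (auto simp: of_nat_diff)
qed

theorem theorem1:
  fixes k :: real
  assumes "k > 0"
  shows "{c. exceptional_value k c} =
           {- sqrt (2 * k * real n - (real n)\<^sup>2) | n :: nat. 1 \<le> n \<and> real n < k} \<and>
         (\<forall>n::nat. 1 \<le> n \<and> real n < k \<longrightarrow>
           (\<forall>c. exceptional_value_with_index k (n - 1) c \<longleftrightarrow>
                c = - sqrt (2 * k * real n - (real n)\<^sup>2))) \<and>
         (\<forall>N::nat. real N < k \<and> k \<le> real N + 1 \<longrightarrow>
           finite {c. exceptional_value k c} \<and> card {c. exceptional_value k c} = N)"
  unfolding candidate_def[symmetric]
proof (intro conjI allI impI)
  show all_values: "{c. exceptional_value k c} = {candidate k n | n. 1 \<le> n \<and> real n < k}"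
  proof (intro equalityI subsetI)
    fix c assume "c \<in> {c. exceptional_value k c}"
    then obtain \<theta> \<phi> and j :: int where c: "- k < c" "c < 0" and \<theta>: "is_theta_0 k c \<theta>"
      and \<phi>: "is_theta_infinity k c \<phi>" and eq: "\<forall>x>0. \<theta> x = \<phi> x + of_int j * pi"
      unfolding exceptional_value_def by blast
    have "((\<lambda>x. \<phi> x + of_int j * pi) \<longlongrightarrow> theta_minus c k + of_int j * pi) at_top"
      using \<phi> by (intro tendsto_intros) (simp add: is_theta_infinity_def)
    moreover have "\<forall>\<^sub>F x in at_top. \<phi> x + of_int j * pi = \<theta> x"
      using eventually_gt_at_top[of 0] by eventually_elim (use eq in simp)
    ultimately have "(\<theta> \<longlongrightarrow> theta_minus c k - of_int (- j) * pi) at_top"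
      using Lim_transform_eventually by fastforce
    from exceptional_index[OF assms c \<theta> this]
    show "c \<in> {candidate k n | n. 1 \<le> n \<and> real n < k}" by blast
  next
    fix c assume "c \<in> {candidate k n | n. 1 \<le> n \<and> real n < k}"
    then show "c \<in> {c. exceptional_value k c}"
      using candidate_is_exceptional unfolding exceptional_value_with_index_def by blast
  qed
  show "exceptional_value_with_index k (n - 1) c \<longleftrightarrow> c = candidate k n"
    if n: "1 \<le> n \<and> real n < k" for n c
  proof
    assume "exceptional_value_with_index k (n - 1) c"
    then obtain \<theta> where c: "- k < c" "c < 0" and \<theta>: "is_theta_0 k c \<theta>"
      "(\<theta> \<longlongrightarrow> theta_minus c k - of_int (int (n - 1)) * pi) at_top"
      unfolding exceptional_value_with_index_def exceptional_value_def by auto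
    obtain n' :: nat where "int (n - 1) = int n' - 1" "c = candidate k n'"
      using exceptional_index[OF assms c \<theta>] by blast
    moreover from this have "n' = n" using n by linarith
    ultimately show "c = candidate k n" by simp
  qed (use n candidate_is_exceptional in blast)
  fix N :: nat
  assume N: "real N < k \<and> k \<le> real N + 1"
  have "n \<le> N \<longleftrightarrow> real n < k" for n
    using N by linarith
  then have img: "{c. exceptional_value k c} = candidate k ` {1..N}"
    unfolding all_values by (auto simp: image_def)
  have "inj_on (candidate k) {1..N}"
  proof (rule linorder_inj_onI)
    fix m n assume "m < n" "m \<in> {1..N}" "n \<in> {1..N}"
    then show "candidate k m \<noteq> candidate k n"
      using candidate_strict_antimono[of m n k] N by force
  qed auto
  then show "card {c. exceptional_value k c} = N"
    unfolding img by (simp add: card_image)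
  show "finite {c. exceptional_value k c}"
    unfolding img by simp
qed

end
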